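(* Let $\Phi:\mathbb{R}^2\to\mathbb{R}$, $\Phi(x)=W^{(1)}\mathrm{ReLU}(W^{(0)}x+b^{(0)})+b^{(1)}$, be a random shallow ReLU network of width $N=3$, where $W^{(0)}\in\mathbb{R}^{3\times 2}$ has i.i.d. $\mathcal{N}(0,2/3)$ entries, $W^{(1)}\in\mathbb{R}^{1\times 3}$ has i.i.d. $\mathcal{N}(0,1)$ entries, $b^{(0)}_i\sim\mathcal{D}^{(0)}_i$, $b^{(1)}\sim\mathcal{D}^{(1)}_1$ for arbitrary probability distributions on $\mathbb{R}$, all jointly independent. Let $\widetilde{\Phi}(x)=W^{(1)}(W^{(0)}x+b^{(0)})+b^{(1)}$ and let $C>0$ be arbitrary. Then with positive probability $\mathrm{Lip}(\Phi)>C\cdot\mathrm{Lip}(\widetilde{\Phi})$.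
   Context: $\mathrm{ReLU}(t)=\max\{0,t\}$ componentwise; $\mathrm{Lip}(f)=\sup_{x\neq y}|f(x)-f(y)|/\|x-y\|_2$. *)

theory Defs
  imports "HOL-Probability.Probability"
begin

text \<open>Lipschitz constant w.r.t. the Euclidean norm on the domain.\<close>
definition lip_const :: "(real^2 \<Rightarrow> real) \<Rightarrow> real" where
  "lip_const f = (SUP p \<in> {(x, y). x \<noteq> y}. \<bar>f (fst p) - f (snd p)\<bar> / norm (fst p - snd p))"

definition relu_vec :: "real^'n \<Rightarrow> real^'n" where
  "relu_vec v = (\<chi> i. max 0 (v $ i))"

text \<open>Parameter space: (W0 entries, W1 entries, b0 entries, b1).\<close>
type_synonym params = "((3 \<times> 2) \<Rightarrow> real) \<times> (3 \<Rightarrow> real) \<times> (3 \<Rightarrow> real) \<times> real"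

definition W0_of :: "params \<Rightarrow> real^2^3" where
  "W0_of \<omega> = (\<chi> i j. fst \<omega> (i, j))"
definition W1_of :: "params \<Rightarrow> real^3" where  \<comment> \<open>the single row of the 1x3 matrix\<close>
  "W1_of \<omega> = (\<chi> i. fst (snd \<omega>) i)"
definition b0_of :: "params \<Rightarrow> real^3" where
  "b0_of \<omega> = (\<chi> i. fst (snd (snd \<omega>)) i)"
definition b1_of :: "params \<Rightarrow> real" where
  "b1_of \<omega> = snd (snd (snd \<omega>))"

definition relu_net :: "params \<Rightarrow> real^2 \<Rightarrow> real" where
  "relu_net \<omega> x = W1_of \<omega> \<bullet> relu_vec (W0_of \<omega> *v x + b0_of \<omega>) + b1_of \<omega>"

definition lin_net :: "params \<Rightarrow> real^2 \<Rightarrow> real" where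
  "lin_net \<omega> x = W1_of \<omega> \<bullet> (W0_of \<omega> *v x + b0_of \<omega>) + b1_of \<omega>"

text \<open>Gaussian N(0, s^2) given standard deviation s.\<close>
definition gaussian :: "real \<Rightarrow> real measure" where
  "gaussian s = density lborel (normal_density 0 s)"

definition param_measure :: "(3 \<Rightarrow> real measure) \<Rightarrow> real measure \<Rightarrow> params measure" where
  "param_measure D0 D1 =
     (PiM UNIV (\<lambda>_. gaussian (sqrt (2/3)))) \<Otimes>\<^sub>M
     ((PiM UNIV (\<lambda>_. gaussian 1)) \<Otimes>\<^sub>M ((PiM UNIV D0) \<Otimes>\<^sub>M D1))"

end

theory Submission
  imports Defs
begin

text \<open>Take the first-layer weights within \<open>d\<close> of a matrix whose columns sum to zero and the
second-layer weights within \<open>d\<close> of \<open>(1, 1, 1)\<close>. The gradient of the linear network, the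
product of the two weight matrices, is then \<open>O(d)\<close>, whereas far out along the first coordinate
axis only the first neuron is active and the ReLU network has slope close to 2. Such boxes of
weights have positive Gaussian measure. The event is measurable because a Lipschitz constant is
already the supremum of the difference quotients over a countable dense set of pairs.\<close>

definition diff_quot :: "('a::real_normed_vector \<Rightarrow> real) \<Rightarrow> 'a \<times> 'a \<Rightarrow> real" where
  "diff_quot f p = \<bar>f (fst p) - f (snd p)\<bar> / norm (fst p - snd p)"

lemma cSUP_inter_dense:
  fixes g :: "'a::topological_space \<Rightarrow> real"
  assumes "open S" "S \<noteq> {}" "continuous_on S g" "bdd_above (g ` S)"
    and dense: "\<And>X. open X \<Longrightarrow> X \<noteq> {} \<Longrightarrow> \<exists>d\<in>D. d \<in> X"
  shows "(SUP x\<in>D \<inter> S. g x) = (SUP x\<in>S. g x)"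
proof (rule antisym)
  have "D \<inter> S \<noteq> {}"
    using dense[OF assms(1,2)] by blast
  then show "(SUP x\<in>D \<inter> S. g x) \<le> (SUP x\<in>S. g x)"
    using assms(4) by (rule cSUP_subset_mono) auto
  show "(SUP x\<in>S. g x) \<le> (SUP x\<in>D \<inter> S. g x)"
  proof (rule cSUP_least[OF assms(2)], rule ccontr)
    fix x assume "x \<in> S" and "\<not> g x \<le> (SUP x\<in>D \<inter> S. g x)"
    then have "x \<in> S \<inter> g -` {(SUP x\<in>D \<inter> S. g x)<..}"
      by simp
    moreover have "open (S \<inter> g -` {(SUP x\<in>D \<inter> S. g x)<..})"
      using assms(1,3) by (auto intro: continuous_open_preimage)
    ultimately obtain d where d: "d \<in> D \<inter> S" and "g d > (SUP x\<in>D \<inter> S. g x)"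
      using dense by blast
    have "bdd_above (g ` (D \<inter> S))"
      using assms(4) by (rule bdd_above_mono) auto
    with d have "g d \<le> (SUP x\<in>D \<inter> S. g x)"
      by (rule cSUP_upper)
    with \<open>g d > (SUP x\<in>D \<inter> S. g x)\<close> show False
      by simp
  qed
qed

lemma continuous_on_diff_quot:
  assumes "continuous_on UNIV f"
  shows "continuous_on {(x, y). x \<noteq> y} (diff_quot f)"
proof -
  have "continuous_on {(x, y). x \<noteq> y} (\<lambda>p. f (fst p))" "continuous_on {(x, y). x \<noteq> y} (\<lambda>p. f (snd p))"
    by (auto intro!: continuous_on_compose2[OF assms] continuous_intros)
  then show ?thesis
    unfolding diff_quot_def by (intro continuous_intros) auto
qed

lemma diff_quot_le:
  assumes "lipschitz_on K UNIV f"
  shows "diff_quot f p \<le> K"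
proof (cases "fst p = snd p")
  case True
  then show ?thesis
    using lipschitz_on_nonneg[OF assms] by (simp add: diff_quot_def)
next
  case False
  have "\<bar>f (fst p) - f (snd p)\<bar> \<le> K * norm (fst p - snd p)"
    using lipschitz_onD[OF assms] by (simp add: dist_norm dist_real_def)
  with False show ?thesis
    by (simp add: diff_quot_def divide_le_eq)
qed

lemma lip_const_eq_SUP_diff_quot: "lip_const f = (SUP p\<in>{(x, y). x \<noteq> y}. diff_quot f p)"
  unfolding lip_const_def diff_quot_def ..

lemma off_diagonal_nonempty: "{(x, y::real^2). x \<noteq> y} \<noteq> {}"
proof -
  have "(0, axis 1 1) \<in> {(x, y::real^2). x \<noteq> y}"
    by simp
  then show ?thesis
    by blast
qed

lemma lip_const_le:
  assumes "lipschitz_on K UNIV f"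
  shows "lip_const f \<le> K"
  unfolding lip_const_eq_SUP_diff_quot
  by (intro cSUP_least off_diagonal_nonempty diff_quot_le[OF assms])

lemma diff_quot_le_lip_const:
  assumes "lipschitz_on K UNIV f" and "x \<noteq> y"
  shows "\<bar>f x - f y\<bar> / norm (x - y) \<le> lip_const f"
proof -
  have "bdd_above (diff_quot f ` {(x, y). x \<noteq> y})"
    using diff_quot_le[OF assms(1)] by (rule bdd_aboveI2)
  with assms(2) have "diff_quot f (x, y) \<le> lip_const f"
    unfolding lip_const_eq_SUP_diff_quot by (intro cSUP_upper) auto
  then show ?thesis
    by (simp add: diff_quot_def)
qed

lemma lip_const_eq_SUP_dense:
  assumes "lipschitz_on K UNIV f" and "\<And>X. open X \<Longrightarrow> X \<noteq> {} \<Longrightarrow> \<exists>d\<in>D. d \<in> X"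
  shows "lip_const f = (SUP p\<in>D \<inter> {(x, y). x \<noteq> y}. diff_quot f p)"
proof -
  have "open {(x, y::real^2). x \<noteq> y}"
    using open_diagonal_complement by simp
  then show ?thesis
    unfolding lip_const_eq_SUP_diff_quot using assms
    by (intro cSUP_inter_dense[symmetric] off_diagonal_nonempty continuous_on_diff_quot
        lipschitz_on_continuous_on bdd_aboveI2 diff_quot_le) auto
qed

lemma borel_measurable_lip_const:
  assumes "\<And>x. (\<lambda>\<omega>. f \<omega> x) \<in> borel_measurable M"
    and "\<And>\<omega>. lipschitz_on (K \<omega>) UNIV (f \<omega>)"
  shows "(\<lambda>\<omega>. lip_const (f \<omega>)) \<in> borel_measurable M"
proof -
  obtain D :: "((real^2) \<times> (real^2)) set"
    where "countable D" and dense: "\<And>X. open X \<Longrightarrow> X \<noteq> {} \<Longrightarrow> \<exists>d\<in>D. d \<in> X"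
    using countable_dense_exists by blast
  have "(\<lambda>\<omega>. SUP p\<in>D \<inter> {(x, y). x \<noteq> y}. diff_quot (f \<omega>) p) \<in> borel_measurable M"
  proof (rule borel_measurable_cSUP)
    show "countable (D \<inter> {(x, y). x \<noteq> y})"
      using \<open>countable D\<close> by simp
    show "(\<lambda>\<omega>. diff_quot (f \<omega>) p) \<in> borel_measurable M" for p
      unfolding diff_quot_def using assms(1) by measurable
    show "bdd_above ((\<lambda>p. diff_quot (f \<omega>) p) ` (D \<inter> {(x, y). x \<noteq> y}))" for \<omega>
      using diff_quot_le[OF assms(2)] by (rule bdd_aboveI2)
  qed
  moreover have "lip_const (f \<omega>) = (SUP p\<in>D \<inter> {(x, y). x \<noteq> y}. diff_quot (f \<omega>) p)" for \<omega>
    using assms(2) dense by (rule lip_const_eq_SUP_dense)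
  ultimately show ?thesis
    by simp
qed

lemma norm_relu_vec_diff_le: "norm (relu_vec a - relu_vec b) \<le> norm (a - b)"
proof (rule norm_le_componentwise_cart)
  fix i
  have "\<bar>max 0 (a $ i) - max 0 (b $ i)\<bar> \<le> \<bar>a $ i - b $ i\<bar>"
    by (simp add: max_def abs_if)
  then show "norm ((relu_vec a - relu_vec b) $ i) \<le> norm ((a - b) $ i)"
    by (simp add: relu_vec_def)
qed

lemma lipschitz_on_relu_net:
  "lipschitz_on (norm (W1_of \<omega>) * onorm ((*v) (W0_of \<omega>))) UNIV (relu_net \<omega>)"
proof (rule lipschitz_onI)
  fix x y :: "real^2"
  let ?a = "W0_of \<omega> *v x + b0_of \<omega>" and ?b = "W0_of \<omega> *v y + b0_of \<omega>"
  have "\<bar>relu_net \<omega> x - relu_net \<omega> y\<bar> = \<bar>W1_of \<omega> \<bullet> (relu_vec ?a - relu_vec ?b)\<bar>"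
    by (simp add: relu_net_def inner_diff_right)
  also have "\<dots> \<le> norm (W1_of \<omega>) * norm (relu_vec ?a - relu_vec ?b)"
    by (rule Cauchy_Schwarz_ineq2)
  also have "\<dots> \<le> norm (W1_of \<omega>) * norm (W0_of \<omega> *v (x - y))"
    using norm_relu_vec_diff_le[of ?a ?b]
    by (intro mult_left_mono) (simp_all add: matrix_vector_mult_diff_distrib)
  also have "\<dots> \<le> norm (W1_of \<omega>) * (onorm ((*v) (W0_of \<omega>)) * norm (x - y))"
    by (intro mult_left_mono onorm matrix_vector_mul_bounded_linear) simp
  finally show "dist (relu_net \<omega> x) (relu_net \<omega> y)
      \<le> norm (W1_of \<omega>) * onorm ((*v) (W0_of \<omega>)) * dist x y"
    by (simp add: dist_norm dist_real_def mult.assoc)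
qed (simp add: onorm_pos_le matrix_vector_mul_bounded_linear)

lemma lin_net_diff: "lin_net \<omega> x - lin_net \<omega> y = (W1_of \<omega> v* W0_of \<omega>) \<bullet> (x - y)"
  by (simp add: lin_net_def dot_lmul_matrix inner_add_right inner_diff_right matrix_vector_mult_diff_distrib)

lemma lipschitz_on_lin_net: "lipschitz_on (norm (W1_of \<omega> v* W0_of \<omega>)) UNIV (lin_net \<omega>)"
  by (rule lipschitz_onI) (simp_all add: dist_norm dist_real_def lin_net_diff Cauchy_Schwarz_ineq2)

lemma eventually_pos_affine_at_top:
  fixes a b :: real
  assumes "a > 0"
  shows "\<forall>\<^sub>F t in at_top. a * t + b > 0"
  using eventually_gt_at_top[of "- b / a"]
  by eventually_elim (use assms in \<open>simp add: field_simps\<close>)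

lemma relu_net_eventually_affine_on_ray:
  assumes "W0_of \<omega> $ 1 $ 1 > 0" "W0_of \<omega> $ 2 $ 1 < 0" "W0_of \<omega> $ 3 $ 1 < 0"
  shows "\<forall>\<^sub>F t in at_top. relu_net \<omega> (t *\<^sub>R axis 1 1)
           = W1_of \<omega> $ 1 * (W0_of \<omega> $ 1 $ 1 * t + b0_of \<omega> $ 1) + b1_of \<omega>"
proof -
  have preact: "(W0_of \<omega> *v (t *\<^sub>R axis 1 1)) $ i = W0_of \<omega> $ i $ 1 * t" for t i
    by (simp add: matrix_vector_mult_def sum_2 axis_def)
  have "\<forall>\<^sub>F t in at_top. W0_of \<omega> $ 1 $ 1 * t + b0_of \<omega> $ 1 > 0
      \<and> (- W0_of \<omega> $ 2 $ 1) * t + (- b0_of \<omega> $ 2) > 0 \<and> (- W0_of \<omega> $ 3 $ 1) * t + (- b0_of \<omega> $ 3) > 0"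
    using assms by (intro eventually_conj eventually_pos_affine_at_top) auto
  then show ?thesis
    by eventually_elim (simp add: relu_net_def inner_vec_def relu_vec_def sum_3 preact)
qed

lemma lip_const_relu_net_ge:
  assumes "W0_of \<omega> $ 1 $ 1 > 0" "W0_of \<omega> $ 2 $ 1 < 0" "W0_of \<omega> $ 3 $ 1 < 0"
  shows "\<bar>W1_of \<omega> $ 1 * W0_of \<omega> $ 1 $ 1\<bar> \<le> lip_const (relu_net \<omega>)"
proof -
  obtain t where t: "\<And>s. s \<ge> t \<Longrightarrow> relu_net \<omega> (s *\<^sub>R axis 1 1)
      = W1_of \<omega> $ 1 * (W0_of \<omega> $ 1 $ 1 * s + b0_of \<omega> $ 1) + b1_of \<omega>"
    using relu_net_eventually_affine_on_ray[OF assms] by (auto simp: eventually_at_top_linorder)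
  have "(t + 1) *\<^sub>R axis 1 1 - t *\<^sub>R axis 1 1 = (axis 1 1 :: real^2)"
    by (simp add: algebra_simps)
  moreover have "relu_net \<omega> ((t + 1) *\<^sub>R axis 1 1) - relu_net \<omega> (t *\<^sub>R axis 1 1)
      = W1_of \<omega> $ 1 * W0_of \<omega> $ 1 $ 1"
    using t[of t] t[of "t + 1"] by (simp add: algebra_simps)
  ultimately have "\<bar>W1_of \<omega> $ 1 * W0_of \<omega> $ 1 $ 1\<bar>
      = \<bar>relu_net \<omega> ((t + 1) *\<^sub>R axis 1 1) - relu_net \<omega> (t *\<^sub>R axis 1 1)\<bar>
        / norm ((t + 1) *\<^sub>R axis 1 1 - t *\<^sub>R axis 1 1 :: real^2)"
    by simp
  also have "\<dots> \<le> lip_const (relu_net \<omega>)"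
    by (rule diff_quot_le_lip_const[OF lipschitz_on_relu_net]) (simp add: algebra_simps)
  finally show ?thesis .
qed

definition W0_centre :: "3 \<times> 2 \<Rightarrow> real" where
  "W0_centre = (\<lambda>(i, j). if j = 1 then (if i = 1 then 2 else -1)
                        else (if i = 1 then 0 else if i = 2 then 1 else -1))"

definition near_centre :: "real \<Rightarrow> params set" where
  "near_centre d = (\<Pi>\<^sub>E p\<in>UNIV. {W0_centre p - d<..<W0_centre p + d})
                   \<times> (\<Pi>\<^sub>E i\<in>UNIV. {1 - d<..<1 + d}) \<times> UNIV"

lemma W0_centre_column_1: "W0_centre (1, 1) = 2" "W0_centre (2, 1) = -1" "W0_centre (3, 1) = -1"
  by (simp_all add: W0_centre_def)

lemma abs_W0_centre_le: "\<bar>W0_centre p\<bar> \<le> 2"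
  by (simp add: W0_centre_def case_prod_beta)

lemma sum_W0_centre_column: "(\<Sum>i\<in>UNIV. W0_centre (i, j)) = 0"
  using exhaust_2[of j] by (auto simp: W0_centre_def sum_3)

lemma mem_near_centre_iff:
  "\<omega> \<in> near_centre d \<longleftrightarrow>
     (\<forall>i j. \<bar>W0_of \<omega> $ i $ j - W0_centre (i, j)\<bar> < d) \<and> (\<forall>i. \<bar>W1_of \<omega> $ i - 1\<bar> < d)"
  by (cases \<omega>) (simp add: near_centre_def W0_of_def W1_of_def abs_diff_less_iff PiE_iff)

lemma abs_mult_sub_le:
  fixes a c w d :: real
  assumes "\<bar>c - 1\<bar> < d" "\<bar>a - w\<bar> < d" "\<bar>w\<bar> \<le> 2" "d \<le> 1/2"
  shows "\<bar>c * a - w\<bar> \<le> 4 * d"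
proof -
  have "\<bar>c\<bar> \<le> 3/2"
    using assms(1,4) by linarith
  then have "\<bar>c * (a - w)\<bar> \<le> 3/2 * d"
    unfolding abs_mult using assms(2) by (intro mult_mono) auto
  moreover have "\<bar>(c - 1) * w\<bar> \<le> d * 2"
    unfolding abs_mult using assms(1,3) by (intro mult_mono) auto
  moreover have "c * a - w = c * (a - w) + (c - 1) * w"
    by (simp add: algebra_simps)
  ultimately show ?thesis
    by linarith
qed

lemma lip_const_relu_net_near_centre_gt:
  assumes "\<omega> \<in> near_centre d" and "d \<le> 1/2"
  shows "3/4 < lip_const (relu_net \<omega>)"
proof -
  have W0: "\<bar>W0_of \<omega> $ i $ j - W0_centre (i, j)\<bar> < d" and W1: "\<bar>W1_of \<omega> $ i - 1\<bar> < d" for i j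
    using assms(1) by (auto simp: mem_near_centre_iff)
  have "W0_of \<omega> $ 1 $ 1 > 3/2" "W0_of \<omega> $ 2 $ 1 < 0" "W0_of \<omega> $ 3 $ 1 < 0" "W1_of \<omega> $ 1 > 1/2"
    using W0[of 1 1] W0[of 2 1] W0[of 3 1] W1[of 1] assms(2)
    by (simp_all add: W0_centre_column_1 abs_less_iff)
  moreover from this have "1/2 * (3/2) < W1_of \<omega> $ 1 * W0_of \<omega> $ 1 $ 1"
    by (intro mult_strict_mono) auto
  ultimately show ?thesis
    using lip_const_relu_net_ge[of \<omega>] by simp
qed

lemma lip_const_lin_net_near_centre_le:
  assumes "\<omega> \<in> near_centre d" and "d \<le> 1/2"
  shows "lip_const (lin_net \<omega>) \<le> 24 * d"
proof -
  have W0: "\<bar>W0_of \<omega> $ i $ j - W0_centre (i, j)\<bar> < d" and W1: "\<bar>W1_of \<omega> $ i - 1\<bar> < d" for i j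
    using assms(1) by (auto simp: mem_near_centre_iff)
  have entry: "\<bar>(W1_of \<omega> v* W0_of \<omega>) $ j\<bar> \<le> 12 * d" for j
  proof -
    have "(W1_of \<omega> v* W0_of \<omega>) $ j = (\<Sum>i\<in>UNIV. W1_of \<omega> $ i * W0_of \<omega> $ i $ j - W0_centre (i, j))"
      by (simp add: vector_matrix_mult_def sum_subtractf sum_W0_centre_column)
    also have "\<bar>\<dots>\<bar> \<le> (\<Sum>i\<in>UNIV. \<bar>W1_of \<omega> $ i * W0_of \<omega> $ i $ j - W0_centre (i, j)\<bar>)"
      by (rule sum_abs)
    also have "\<dots> \<le> (\<Sum>i\<in>(UNIV :: 3 set). 4 * d)"
      by (rule sum_mono) (rule abs_mult_sub_le[OF W1 W0 abs_W0_centre_le assms(2)])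
    finally show ?thesis
      by simp
  qed
  have "lip_const (lin_net \<omega>) \<le> norm (W1_of \<omega> v* W0_of \<omega>)"
    by (rule lip_const_le[OF lipschitz_on_lin_net])
  also have "\<dots> \<le> (\<Sum>j\<in>UNIV. \<bar>(W1_of \<omega> v* W0_of \<omega>) $ j\<bar>)"
    by (rule norm_le_l1_cart)
  also have "\<dots> \<le> 24 * d"
    using entry[of 1] entry[of 2] by (simp add: sum_2)
  finally show ?thesis .
qed

lemma prob_space_gaussian: "s > 0 \<Longrightarrow> prob_space (gaussian s)"
  unfolding gaussian_def by (rule prob_space_normal_density)

lemma sets_gaussian: "sets (gaussian s) = sets borel"
  by (simp add: gaussian_def)

lemma emeasure_gaussian_Ioo_pos:
  assumes "s > 0" and "a < b"
  shows "0 < emeasure (gaussian s) {a<..<b}"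
proof (rule ccontr)
  assume "\<not> ?thesis"
  then have "{a<..<b} \<in> null_sets (density lborel (normal_density 0 s))"
    by (simp add: null_sets_def gaussian_def)
  then have "AE x in lborel. x \<in> {a<..<b} \<longrightarrow> ennreal (normal_density 0 s x) = 0"
    by (simp add: null_sets_density_iff)
  moreover have "ennreal (normal_density 0 s x) \<noteq> 0" for x
    using normal_density_pos[OF assms(1), of 0 x] by simp
  ultimately have "AE x in lborel. x \<notin> {a<..<b}"
    by (auto elim: eventually_mono)
  then have "{a<..<b} \<in> null_sets lborel"
    by (simp add: AE_iff_null_sets)
  with assms(2) show False
    by (simp add: null_sets_def)
qed

lemma emeasure_PiM_PiE_pos:
  fixes M :: "'i::finite \<Rightarrow> 'a measure"
  assumes "\<And>i. sigma_finite_measure (M i)" "\<And>i. A i \<in> sets (M i)" "\<And>i. 0 < emeasure (M i) (A i)"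
  shows "0 < emeasure (PiM UNIV M) (PiE UNIV A)"
proof -
  interpret product_sigma_finite M
    using assms(1) by (simp add: product_sigma_finite_def)
  have "emeasure (PiM UNIV M) (PiE UNIV A) = (\<Prod>i\<in>UNIV. emeasure (M i) (A i))"
    using assms(2) by (intro emeasure_PiM) auto
  then show ?thesis
    using assms(3) by (simp add: zero_less_iff_neq_zero prod_zero_iff)
qed

context
  fixes D0 :: "3 \<Rightarrow> real measure" and D1 :: "real measure"
  assumes sets_D0: "\<And>i. sets (D0 i) = sets borel" and sets_D1: "sets D1 = sets borel"
begin

lemma sets_param_measure:
  "sets (param_measure D0 D1)
     = sets (PiM UNIV (\<lambda>_. borel) \<Otimes>\<^sub>M (PiM UNIV (\<lambda>_. borel) \<Otimes>\<^sub>M (PiM UNIV (\<lambda>_. borel) \<Otimes>\<^sub>M borel)))"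
  unfolding param_measure_def
  by (intro sets_pair_measure_cong sets_PiM_cong) (simp_all add: sets_gaussian sets_D0 sets_D1)

lemma space_param_measure: "space (param_measure D0 D1) = UNIV"
  using sets_eq_imp_space_eq[OF sets_param_measure] by (simp add: space_pair_measure space_PiM)

lemma borel_measurable_relu_net: "(\<lambda>\<omega>. relu_net \<omega> x) \<in> borel_measurable (param_measure D0 D1)"
  unfolding measurable_cong_sets[OF sets_param_measure refl] relu_net_def inner_vec_def relu_vec_def
    matrix_vector_mult_def W0_of_def W1_of_def b0_of_def b1_of_def
  by simp measurable

lemma borel_measurable_lin_net: "(\<lambda>\<omega>. lin_net \<omega> x) \<in> borel_measurable (param_measure D0 D1)"
  unfolding measurable_cong_sets[OF sets_param_measure refl] lin_net_def inner_vec_def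
    matrix_vector_mult_def W0_of_def W1_of_def b0_of_def b1_of_def
  by simp measurable

lemma sets_lip_const_gap:
  "{\<omega> \<in> space (param_measure D0 D1). C * lip_const (lin_net \<omega>) < lip_const (relu_net \<omega>)}
     \<in> sets (param_measure D0 D1)"
  by (intro borel_measurable_less borel_measurable_times borel_measurable_const
      borel_measurable_lip_const[OF borel_measurable_lin_net lipschitz_on_lin_net]
      borel_measurable_lip_const[OF borel_measurable_relu_net lipschitz_on_relu_net])

lemma emeasure_near_centre_pos:
  assumes "\<And>i. prob_space (D0 i)" and "prob_space D1" and "d > 0"
  shows "0 < emeasure (param_measure D0 D1) (near_centre d)"
proof -
  let ?P0 = "PiM UNIV (\<lambda>_::3 \<times> 2. gaussian (sqrt (2/3)))" and ?P1 = "PiM UNIV (\<lambda>_::3. gaussian 1)"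
  let ?B0 = "\<Pi>\<^sub>E p\<in>UNIV. {W0_centre p - d<..<W0_centre p + d}" and ?B1 = "\<Pi>\<^sub>E (i::3)\<in>UNIV. {1 - d<..<1 + d}"
  let ?P2 = "PiM UNIV D0 \<Otimes>\<^sub>M D1"
  have "prob_space ?P2"
    using assms(1,2) by (intro prob_space_pair prob_space_PiM)
  moreover have "space ?P2 = UNIV"
    by (simp add: space_pair_measure space_PiM sets_eq_imp_space_eq[OF sets_D0]
        sets_eq_imp_space_eq[OF sets_D1])
  ultimately have P2: "sigma_finite_measure ?P2" "emeasure ?P2 UNIV = 1"
    by (metis prob_space_imp_sigma_finite prob_space.emeasure_space_1)+
  have P12: "sigma_finite_measure (?P1 \<Otimes>\<^sub>M ?P2)"
    by (intro prob_space_imp_sigma_finite prob_space_pair[OF prob_space_PiM \<open>prob_space ?P2\<close>]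
        prob_space_gaussian) simp
  have B: "?B0 \<in> sets ?P0" "?B1 \<in> sets ?P1"
    by (auto intro!: sets_PiM_I_finite simp: sets_gaussian)
  have "0 < emeasure ?P0 ?B0" "0 < emeasure ?P1 ?B1"
    using assms(3)
    by (auto intro!: emeasure_PiM_PiE_pos emeasure_gaussian_Ioo_pos prob_space_imp_sigma_finite
        prob_space_gaussian simp: sets_gaussian)
  moreover have "emeasure (?P1 \<Otimes>\<^sub>M ?P2) (?B1 \<times> UNIV) = emeasure ?P1 ?B1"
    using sigma_finite_measure.emeasure_pair_measure_Times[OF P2(1) B(2), of UNIV]
      sets.top[of ?P2] \<open>space ?P2 = UNIV\<close> P2(2) by simp
  moreover have "emeasure (param_measure D0 D1) (near_centre d)
      = emeasure ?P0 ?B0 * emeasure (?P1 \<Otimes>\<^sub>M ?P2) (?B1 \<times> UNIV)"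
    unfolding param_measure_def near_centre_def
    using sets.top[of ?P2] \<open>space ?P2 = UNIV\<close> B
    by (intro sigma_finite_measure.emeasure_pair_measure_Times[OF P12]) auto
  ultimately show ?thesis
    by (simp add: zero_less_iff_neq_zero)
qed

end

lemma prob_space_param_measure:
  assumes "\<And>i. prob_space (D0 i)" and "prob_space D1"
  shows "prob_space (param_measure D0 D1)"
  unfolding param_measure_def using assms
  by (intro prob_space_pair prob_space_PiM prob_space_gaussian) auto

theorem proposition4p7:
  fixes D0 :: "3 \<Rightarrow> real measure" and D1 :: "real measure" and C :: real
  assumes "\<And>i. prob_space (D0 i)" and "\<And>i. sets (D0 i) = sets borel"
    and "prob_space D1" and "sets D1 = sets borel"
    and "C > 0"
  shows "measure (param_measure D0 D1)
           {\<omega> \<in> space (param_measure D0 D1).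
              lip_const (relu_net \<omega>) > C * lip_const (lin_net \<omega>)} > 0"
proof -
  let ?M = "param_measure D0 D1"
  let ?gap = "{\<omega> \<in> space ?M. lip_const (relu_net \<omega>) > C * lip_const (lin_net \<omega>)}"
  define d where "d = min (1/2) (1 / (50 * C))"
  have d: "0 < d" "d \<le> 1/2" "C * (24 * d) < 3/4"
    using \<open>C > 0\<close> by (auto simp: d_def min_def field_simps)
  have "near_centre d \<subseteq> ?gap"
  proof
    fix \<omega> assume "\<omega> \<in> near_centre d"
    with d have "lip_const (lin_net \<omega>) \<le> 24 * d" "3/4 < lip_const (relu_net \<omega>)"
      by (blast intro: lip_const_lin_net_near_centre_le lip_const_relu_net_near_centre_gt)+
    then have "C * lip_const (lin_net \<omega>) < lip_const (relu_net \<omega>)"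
      using mult_left_mono[of "lip_const (lin_net \<omega>)" "24 * d" C] \<open>C > 0\<close> d(3) by linarith
    then show "\<omega> \<in> ?gap"
      by (simp add: space_param_measure assms(2,4))
  qed
  then have "0 < emeasure ?M ?gap"
    using emeasure_near_centre_pos[OF assms(2,4,1,3) d(1)] sets_lip_const_gap[OF assms(2,4)]
    by (meson emeasure_mono less_le_trans)
  with prob_space.finite_measure[OF prob_space_param_measure[OF assms(1,3)]] show ?thesis
    by (simp add: finite_measure.emeasure_eq_measure)
qed

end
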